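(* (Assuming the axiom of choice.) Every connected graph admits a traversal.
   Context: Graphs are undirected, and may be infinite. A traversal of a connected graph $(V,E)$ is a linear ordering $<$ of $V$ such that the subgraph of $(V,E)$ induced by any initial segment of $(V,<)$ (i.e., any subset of $V$ that is downward closed under $<$) is connected. *)

theory Defs
  imports "Graph_Theory.Digraph_Component"
begin

text \<open>
  As in Graph_Theory, an undirected simple graph is a symmetric digraph without loops and
  parallel arcs. This is the locale \<^locale>\<open>graph\<close> without its finiteness requirements.
\<close>

locale inf_graph = loopfree_digraph + nomulti_digraph + sym_digraph

text \<open>
  The library's \<^const>\<open>Digraph_Component.connected\<close> excludes the null graph. Here the null graph
  counts as connected, since the empty set is an initial segment of every linear order.
\<close>

definition connected_graph :: "('a, 'b) pre_digraph \<Rightarrow> bool" where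
  "connected_graph G \<longleftrightarrow> verts G = {} \<or> Digraph_Component.connected G"

definition initial_segment :: "'a set \<Rightarrow> 'a rel \<Rightarrow> 'a set \<Rightarrow> bool" where
  "initial_segment V r S \<longleftrightarrow> S \<subseteq> V \<and> (\<forall>x\<in>S. \<forall>y\<in>V. (y, x) \<in> r \<longrightarrow> y \<in> S)"

text \<open>
  The linear order is given by its reflexive relation: \<open>(x, y) \<in> r\<close> means \<open>x \<le> y\<close>.
  It need not be a well-order.
\<close>

definition traversal :: "('a, 'b) pre_digraph \<Rightarrow> 'a rel \<Rightarrow> bool" where
  "traversal G r \<longleftrightarrow> linear_order_on (verts G) r \<and>
     (\<forall>S. initial_segment (verts G) r S \<longrightarrow> connected_graph (G \<restriction> S))"

end

theory Submission
  imports Defs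
begin

text \<open>
  Fix a root \<open>u\<close> and order the vertices by their distance from \<open>u\<close>, comparing vertices at the
  same distance by an arbitrary linear order (this is the only use of choice). In a connected
  graph every distance is finite, even if the graph is infinite, and a vertex at distance
  \<open>n + 1\<close> has a neighbour at distance \<open>n\<close>. That neighbour comes strictly earlier, so it lies in
  every initial segment that contains the vertex (\<open>nearer_neighbour\<close>). By induction on the
  distance, each vertex of an initial segment is joined to \<open>u\<close> inside the segment, whatever
  order was chosen within the distance levels. Hence the segment is connected
  (\<open>connected_graph_if_nearer_neighbours\<close>).
\<close>

definition refined_order :: "'a set \<Rightarrow> ('a \<Rightarrow> nat) \<Rightarrow> 'a rel \<Rightarrow> 'a rel" where
  "refined_order V f w =
     {(x, y). x \<in> V \<and> y \<in> V \<and> (f x < f y \<or> f x = f y \<and> (x, y) \<in> w)}"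

lemma linear_order_on_refined_order:
  assumes "linear_order_on V w"
  shows "linear_order_on V (refined_order V f w)"
proof -
  have w: "refl_on V w" "trans w" "antisym w" "total_on V w"
    using assms by (auto simp: order_on_defs)
  have "refl_on V (refined_order V f w)"
    using w(1) by (auto simp: refined_order_def refl_on_def)
  moreover have "trans (refined_order V f w)"
    using w(2) by (auto simp: refined_order_def trans_def)
  moreover have "antisym (refined_order V f w)"
    using w(3) by (auto simp: refined_order_def antisym_def)
  moreover have "total_on V (refined_order V f w)"
    using w(4) by (auto simp: refined_order_def total_on_def)
  ultimately show ?thesis
    by (auto simp: order_on_defs refined_order_def)
qed

text \<open>
  The value is meaningful only if some walk leads from \<open>u\<close> to \<open>v\<close>; otherwise \<open>LEAST\<close>
  ranges over an empty set and returns an unspecified number.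
\<close>

definition hop_distance :: "('a, 'b) pre_digraph \<Rightarrow> 'a \<Rightarrow> 'a \<Rightarrow> nat" where
  "hop_distance G u v = (LEAST n. (u, v) \<in> arcs_ends G ^^ n)"

text \<open>
  The last vertex before \<open>v\<close> on a shortest walk from \<open>u\<close> is reached in one step less.
\<close>

lemma nearer_neighbour:
  assumes "u \<rightarrow>\<^sup>*\<^bsub>G\<^esub> v" "v \<noteq> u"
  obtains x where "(x, v) \<in> arcs_ends G" "hop_distance G u x < hop_distance G u v"
proof -
  have "(u, v) \<in> (arcs_ends G)\<^sup>*"
    using assms(1) unfolding reachable_def by (rule rtrancl_on_rtranclI)
  then obtain k where "(u, v) \<in> arcs_ends G ^^ k"
    using rtrancl_power by blast
  then have walk: "(u, v) \<in> arcs_ends G ^^ hop_distance G u v"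
    unfolding hop_distance_def by (rule LeastI)
  then obtain n where n: "hop_distance G u v = Suc n"
    using assms(2) by (cases "hop_distance G u v") auto
  then obtain x where x: "(u, x) \<in> arcs_ends G ^^ n" "(x, v) \<in> arcs_ends G"
    using walk by auto
  have "hop_distance G u x \<le> n"
    unfolding hop_distance_def using x(1) by (rule Least_le)
  then show ?thesis using that x(2) n by simp
qed

text \<open>
  The function \<open>f\<close> only has to make the descent terminate: moving repeatedly to a neighbour
  with a smaller value can stop nowhere but at \<open>u\<close>, so every vertex is joined to \<open>u\<close>. Thus
  distances measured in a larger graph can serve for a subgraph \<open>H\<close>.
\<close>

lemma connected_graph_if_nearer_neighbours:
  fixes f :: "'a \<Rightarrow> nat"
  assumes "u \<in> verts H"
    and nearer: "\<And>v. v \<in> verts H \<Longrightarrow> v \<noteq> u \<Longrightarrow>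
      \<exists>x\<in>verts H. (x, v) \<in> arcs_ends H \<and> f x < f v"
  shows "connected_graph H"
proof -
  let ?R = "rtrancl_on (verts H) ((arcs_ends H)\<^sup>s)"
  have from_root: "(u, v) \<in> ?R" if "v \<in> verts H" for v
    using that
  proof (induction "f v" arbitrary: v rule: less_induct)
    case less
    show ?case
    proof (cases "v = u")
      case True
      then show ?thesis using assms(1) by auto
    next
      case False
      then obtain x where x: "x \<in> verts H" "(x, v) \<in> arcs_ends H" "f x < f v"
        using nearer less.prems by blast
      then have "(u, x) \<in> ?R" using less.hyps by blast
      then show ?thesis
        by (rule rtrancl_on_into_rtrancl_on) (use x less.prems in \<open>auto simp: symcl_def\<close>)
    qed
  qed
  have "sym ?R" by (intro rtrancl_on_sym) (auto simp: sym_def symcl_def)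
  then have "(v, w) \<in> ?R" if "v \<in> verts H" "w \<in> verts H" for v w
    using from_root[OF that(1)] from_root[OF that(2)] by (metis symE rtrancl_on_trans)
  then show ?thesis
    using assms(1) by (auto simp: connected_graph_def connected_conv)
qed

theorem theorem1p2:
  fixes G :: "('a, 'b) pre_digraph"
  assumes "inf_graph G"
    and "connected_graph G"
  shows "\<exists>r. traversal G r"
proof -
  interpret inf_graph G by fact
  obtain w where w: "linear_order_on (verts G) w"
    using well_order_on[of "verts G"] by (auto simp: well_order_on_def)
  show ?thesis
  proof (cases "verts G = {}")
    case True
    then have "traversal G w"
      using w by (auto simp: traversal_def initial_segment_def connected_graph_def)
    then show ?thesis ..
  next
    case False
    then obtain u where u: "u \<in> verts G" by blast
    have "strongly_connected G"
      using assms(2) False sym_arcs symmetric_connected_imp_strongly_connected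
      by (auto simp: connected_graph_def)
    then have reach: "u \<rightarrow>\<^sup>*\<^bsub>G\<^esub> v" if "v \<in> verts G" for v
      using u that by (auto simp: strongly_connected_def)
    define f where "f = hop_distance G u"
    define r where "r = refined_order (verts G) f w"
    have "connected_graph (G \<restriction> S)" if S: "initial_segment (verts G) r S" for S
    proof (cases "S = {}")
      case True
      then show ?thesis by (simp add: connected_graph_def)
    next
      case False
      have subset: "S \<subseteq> verts G"
        using S by (simp add: initial_segment_def)
      have closed: "x \<in> S" if "v \<in> S" "x \<in> verts G" "f x < f v" for x v
        using S subset that unfolding initial_segment_def r_def refined_order_def by blast
      have nearer: "\<exists>x\<in>S. (x, v) \<in> arcs_ends (G \<restriction> S) \<and> f x < f v"
        if v: "v \<in> S" "v \<noteq> u" for v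
      proof -
        obtain x where x: "(x, v) \<in> arcs_ends G" "f x < f v"
          using nearer_neighbour[OF reach v(2)] v(1) subset unfolding f_def by blast
        then have "x \<in> S" using closed v(1) adj_in_verts by blast
        moreover from this have "(x, v) \<in> arcs_ends (G \<restriction> S)"
          using x(1) v(1) by (auto simp: arcs_ends_conv)
        ultimately show ?thesis using x(2) by blast
      qed
      \<comment> \<open>A vertex of \<open>S\<close> of least distance has no nearer neighbour, so it is the root.\<close>
      obtain m where "m \<in> S" "\<And>y. y \<in> S \<Longrightarrow> f m \<le> f y"
        using ex_has_least_nat[of "\<lambda>x. x \<in> S" _ f] False by blast
      then have "u \<in> S" using nearer by (metis not_le)
      then show ?thesis
        using nearer by (intro connected_graph_if_nearer_neighbours[of u _ f]) auto
    qed
    then have "traversal G r"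
      using linear_order_on_refined_order[OF w] by (simp add: traversal_def r_def)
    then show ?thesis ..
  qed
qed

end
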